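(* Let $1/2\le\theta\le1$ and $0\le\mu\le1$, and for a step size $\tau>0$ let $(u^n)_{n\ge0}$ be the sequence generated by the $(\theta,\mu)$-method with constant step size $\tau$ and fixed initial value $u^0$ (described in the context). The constants below are independent of $m$ and of $\tau$. (a) There exists $c_1>0$ such that $\big\||u^m|^2-1\big\|_{L^1(\Omega)}\le c_1\tau$ for all $m\ge2$, unconditionally. (b) Let $\mu=1/2$. There exists $c_2>0$ such that $\big\||u^m|^2-1\big\|_{L^1(\Omega)}\le c_2\tau^2$ for $m\ge2$ if and only if there exists $c>0$ such that $$\|d_tu^m\|^2+\|d_tu^1\|^2+\tau^2\sum_{n=2}^m\|d_t^2u^n\|^2\le c\qquad\text{for } m\ge2 .$$ The constants $c_1,c_2>0$ depend on the energy $\frac12\|\nabla u^0\|^2$ of $u^0$ and on the constant $c_\star$ (from the context); $c_2$ depends also on the constant $c$.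
   Context: Setting. $\Omega\subset\mathbb{R}^d$ is a bounded domain with Lipschitz boundary, $\Gamma_D\subset\partial\Omega$ has positive surface measure, and $u_D:\Gamma_D\to\mathbb{R}^\ell$ is the trace of some $\tilde u_D\in H^1(\Omega;\mathbb{R}^\ell)$ with $|\tilde u_D|=1$ a.e. in $\Omega$. $H^1_D(\Omega;\mathbb{R}^\ell)$ is the subspace of $H^1(\Omega;\mathbb{R}^\ell)$ of functions with vanishing trace on $\Gamma_D$. $(\cdot,\cdot)$ and $\|\cdot\|$ are the $L^2(\Omega)$ inner product and norm; $|\cdot|$ is the Euclidean length and $\cdot$ between vectors the Euclidean inner product in $\mathbb{R}^\ell$ (applied pointwise to vector fields). $(\cdot,\cdot)_\star$ is either the $L^2$-inner product $(\cdot,\cdot)$ or the $H^1$-inner product $(\nabla\cdot,\nabla\cdot)$ on $H^1_D(\Omega;\mathbb{R}^\ell)$, with induced norm $\|\cdot\|_\star$. There is a constant $c_\star>0$ with $\|v\|\le c_\star^{1/2}\|v\|_\star$ for all $v\in H^1_D(\Omega;\mathbb{R}^\ell)$. The $(\theta,\mu)$-method with constant step size $\tau>0$. Write $d_tu^n:=(u^n-u^{n-1})/\tau$ for $n\ge1$ and $d_t^2u^n:=(d_tu^n-d_tu^{n-1})/\tau$ for $n\ge2$. Choose $u^0\in H^1(\Omega;\mathbb{R}^\ell)$ with $u^0|_{\Gamma_D}=u_D$ and $|u^0|=1$ a.e. in $\Omega$. Step 1 (implicit Euler): $d_tu^1\in H^1_D(\Omega;\mathbb{R}^\ell)$ satisfies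 $d_tu^1\cdot u^0=0$ a.e. in $\Omega$ and $(d_tu^1,v)_\star+(\nabla[u^0+\tau d_tu^1],\nabla v)=0$ for all $v\in H^1_D(\Omega;\mathbb{R}^\ell)$ with $v\cdot u^0=0$ a.e.; set $u^1=u^0+\tau d_tu^1$. Step $n\ge2$: set $\widehat u^{\,n-1+\mu}:=u^{n-1}+\mu\tau d_tu^{n-1}$; $d_tu^n\in H^1_D(\Omega;\mathbb{R}^\ell)$ satisfies $d_tu^n\cdot\widehat u^{\,n-1+\mu}=0$ a.e. in $\Omega$ and $(d_tu^n,v)_\star+(\nabla[u^{n-1}+\theta\tau d_tu^n],\nabla v)=0$ for all $v\in H^1_D(\Omega;\mathbb{R}^\ell)$ with $v\cdot\widehat u^{\,n-1+\mu}=0$ a.e.; set $u^n=u^{n-1}+\tau d_tu^n$. (In the algorithm a stopping test may truncate the sequence; it plays no other role, so the iteration is regarded as continued for all $n$.) *)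

theory Defs
  imports "HOL-Analysis.Analysis"
begin

section \<open>Hausdorff measure\<close>

text \<open>
  The Hausdorff measure is normalised such that it agrees with the classical surface measure on
  Lipschitz hypersurfaces. The empty set is treated separately because
  \<open>0 ^ 0 = 1\<close>; a nonempty set of diameter \<open>0\<close> has to contribute \<open>1\<close> for \<open>s = 0\<close>.
  Boundedness is required explicitly since \<^const>\<open>diameter\<close> is meaningless on unbounded sets.
\<close>

definition hausdorff_gauge :: "nat \<Rightarrow> 'a::euclidean_space set \<Rightarrow> ennreal" where
  "hausdorff_gauge s C =
     (if C = {} then 0 else ennreal (unit_ball_vol (real s) * (diameter C / 2) ^ s))"

definition hausdorff_pre :: "nat \<Rightarrow> real \<Rightarrow> 'a::euclidean_space set \<Rightarrow> ennreal" where
  "hausdorff_pre s \<delta> A =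
     (INF C \<in> {C :: nat \<Rightarrow> 'a set. A \<subseteq> (\<Union>i. C i) \<and> (\<forall>i. bounded (C i) \<and> diameter (C i) \<le> \<delta>)}.
        \<Sum>i. hausdorff_gauge s (C i))"

definition hausdorff_outer :: "nat \<Rightarrow> 'a::euclidean_space set \<Rightarrow> ennreal" where
  "hausdorff_outer s A = (SUP \<delta>\<in>{0<..}. hausdorff_pre s \<delta> A)"

definition hausdorff_measure :: "nat \<Rightarrow> 'a::euclidean_space measure" where
  "hausdorff_measure s =
     measure_of UNIV (lambda_system UNIV UNIV (hausdorff_outer s)) (hausdorff_outer s)"

lemma hausdorff_pre_empty:
  assumes "\<delta> > 0"
  shows "hausdorff_pre s \<delta> ({} :: 'a::euclidean_space set) = 0"
proof -
  have "hausdorff_pre s \<delta> ({} :: 'a set) \<le> 0"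
    unfolding hausdorff_pre_def using assms
    by (intro INF_lower2[of "\<lambda>_. {}"]) (auto simp: hausdorff_gauge_def)
  then show ?thesis by simp
qed

lemma hausdorff_pre_mono: "A \<subseteq> B \<Longrightarrow> hausdorff_pre s \<delta> A \<le> hausdorff_pre s \<delta> B"
  unfolding hausdorff_pre_def by (rule INF_superset_mono) auto

lemma hausdorff_pre_lessD:
  assumes "hausdorff_pre s \<delta> A < e"
  shows "\<exists>C. A \<subseteq> (\<Union>i. C i) \<and> (\<forall>i. bounded (C i) \<and> diameter (C i) \<le> \<delta>) \<and>
    (\<Sum>i. hausdorff_gauge s (C i)) \<le> e"
  using assms unfolding hausdorff_pre_def INF_less_iff by (blast intro: less_imp_le)

lemma hausdorff_pre_subadditive:
  "hausdorff_pre s \<delta> (\<Union>i::nat. A i) \<le> (\<Sum>i. hausdorff_pre s \<delta> (A i))"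
proof (rule ennreal_le_epsilon)
  fix e :: real
  assume e: "0 < e" and fin: "(\<Sum>i. hausdorff_pre s \<delta> (A i)) < top"
  have "\<exists>C. A n \<subseteq> (\<Union>i. C i) \<and> (\<forall>i. bounded (C i) \<and> diameter (C i) \<le> \<delta>) \<and>
      (\<Sum>i. hausdorff_gauge s (C i)) \<le> hausdorff_pre s \<delta> (A n) + e * (1/2) ^ Suc n" for n
  proof -
    have "hausdorff_pre s \<delta> (A n) < hausdorff_pre s \<delta> (A n) + ennreal (e * (1/2) ^ Suc n)"
      using e fin by (auto simp: less_top dest!: ennreal_suminf_lessD)
    then show ?thesis by (rule hausdorff_pre_lessD)
  qed
  then obtain C where C: "\<And>n. A n \<subseteq> (\<Union>i. C n i)"
      "\<And>n i. bounded (C n i) \<and> diameter (C n i) \<le> \<delta>"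
      "\<And>n. (\<Sum>i. hausdorff_gauge s (C n i)) \<le> hausdorff_pre s \<delta> (A n) + e * (1/2) ^ Suc n"
    by metis
  define D where "D k = case_prod C (prod_decode k)" for k
  have "hausdorff_pre s \<delta> (\<Union>i. A i) \<le> (\<Sum>k. hausdorff_gauge s (D k))"
    unfolding hausdorff_pre_def
  proof (intro INF_lower CollectI conjI allI)
    show "(\<Union>i. A i) \<subseteq> (\<Union>k. D k)"
    proof clarify
      fix x i assume "x \<in> A i"
      then obtain j where "x \<in> C i j" using C(1)[of i] by auto
      then show "x \<in> (\<Union>k. D k)"
        by (auto simp: D_def intro!: exI[of _ "prod_encode (i, j)"])
    qed
  qed (use C(2) in \<open>auto simp: D_def split: prod.splits\<close>)
  also have "\<dots> = (\<Sum>n. \<Sum>i. hausdorff_gauge s (C n i))"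
    using suminf_ennreal_2dimen[of "\<lambda>n. \<Sum>i. hausdorff_gauge s (C n i)"
        "\<lambda>p. hausdorff_gauge s (case_prod C p)"]
    by (simp add: D_def comp_def)
  also have "\<dots> \<le> (\<Sum>n. hausdorff_pre s \<delta> (A n) + e * (1/2) ^ Suc n)"
    by (intro suminf_le) (use C(3) in auto)
  also have "\<dots> = (\<Sum>n. hausdorff_pre s \<delta> (A n)) + (\<Sum>n. ennreal e * ennreal ((1/2) ^ Suc n))"
    using e by (subst suminf_add[symmetric])
      (auto simp del: ennreal_suminf_cmult simp add: ennreal_mult[symmetric])
  also have "\<dots> = (\<Sum>n. hausdorff_pre s \<delta> (A n)) + ennreal e"
    unfolding ennreal_suminf_cmult
    by (subst suminf_ennreal_eq[OF zero_le_power power_half_series]) auto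
  finally show "hausdorff_pre s \<delta> (\<Union>i. A i) \<le> (\<Sum>i. hausdorff_pre s \<delta> (A i)) + ennreal e" .
qed

lemma outer_measure_space_hausdorff:
  "outer_measure_space UNIV (hausdorff_outer s :: 'a::euclidean_space set \<Rightarrow> ennreal)"
  (is "outer_measure_space UNIV ?H")
  unfolding outer_measure_space_def
proof (intro conjI)
  show "positive UNIV ?H"
    by (simp add: positive_def hausdorff_outer_def hausdorff_pre_empty)
  show "increasing UNIV ?H"
    unfolding increasing_def hausdorff_outer_def by (blast intro: SUP_mono hausdorff_pre_mono)
  show "countably_subadditive UNIV ?H"
    unfolding countably_subadditive_def
  proof (intro allI impI)
    fix A :: "nat \<Rightarrow> 'a set"
    show "hausdorff_outer s (\<Union>i. A i) \<le> (\<Sum>i. hausdorff_outer s (A i))"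
      unfolding hausdorff_outer_def[of s "\<Union>i. A i"]
    proof (rule SUP_least)
      fix \<delta> :: real assume "\<delta> \<in> {0<..}"
      then have "(\<Sum>i. hausdorff_pre s \<delta> (A i)) \<le> (\<Sum>i. hausdorff_outer s (A i))"
        by (intro suminf_le) (auto simp: hausdorff_outer_def intro: SUP_upper)
      then show "hausdorff_pre s \<delta> (\<Union>i. A i) \<le> (\<Sum>i. hausdorff_outer s (A i))"
        using hausdorff_pre_subadditive order_trans by blast
    qed
  qed
qed

lemma measure_space_hausdorff:
  "measure_space UNIV (lambda_system UNIV UNIV (hausdorff_outer s)) (hausdorff_outer s)"
  using sigma_algebra.caratheodory_lemma[OF sigma_algebra_Pow, of UNIV "hausdorff_outer s"]
    outer_measure_space_hausdorff[of s] by simp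

lemma sets_hausdorff_measure:
  "sets (hausdorff_measure s) = lambda_system UNIV UNIV (hausdorff_outer s)"
  unfolding hausdorff_measure_def
  by (intro sigma_algebra.sets_measure_of_eq
      measure_space_hausdorff[unfolded measure_space_def, THEN conjunct1])

lemma emeasure_hausdorff_measure:
  assumes "A \<in> sets (hausdorff_measure s)"
  shows "emeasure (hausdorff_measure s) A = hausdorff_outer s A"
  unfolding hausdorff_measure_def
  using measure_space_hausdorff assms[unfolded sets_hausdorff_measure]
  unfolding measure_space_def
  by (intro emeasure_measure_of_sigma) blast+

section \<open>Lipschitz domains\<close>

text \<open>
  Near each boundary point the domain is the part of a ball lying strictly above the graph of a
  Lipschitz function over the hyperplane orthogonal to some unit vector \<open>\<nu>\<close>.
\<close>

definition lipschitz_boundary :: "'a::euclidean_space set \<Rightarrow> bool" where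
  "lipschitz_boundary \<Omega> \<longleftrightarrow>
     (\<forall>p\<in>frontier \<Omega>. \<exists>r>0. \<exists>\<nu> L. \<exists>\<gamma> :: 'a \<Rightarrow> real.
        norm \<nu> = 1 \<and> L-lipschitz_on {y. y \<bullet> \<nu> = 0} \<gamma> \<and>
        (\<forall>x\<in>ball p r. x \<in> \<Omega> \<longleftrightarrow> x \<bullet> \<nu> > \<gamma> (x - (x \<bullet> \<nu>) *\<^sub>R \<nu>)))"

definition bounded_lipschitz_domain :: "'a::euclidean_space set \<Rightarrow> bool" where
  "bounded_lipschitz_domain \<Omega> \<longleftrightarrow>
     \<Omega> \<noteq> {} \<and> open \<Omega> \<and> connected \<Omega> \<and> bounded \<Omega> \<and> lipschitz_boundary \<Omega>"

definition boundary_measure :: "(real ^ 'd) set \<Rightarrow> (real ^ 'd) measure" where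
  "boundary_measure \<Omega> = restrict_space (hausdorff_measure (CARD('d) - 1)) (frontier \<Omega>)"

section \<open>Smooth functions and Sobolev spaces\<close>

primrec Ck :: "nat \<Rightarrow> ('a::euclidean_space \<Rightarrow> 'b::real_normed_vector) \<Rightarrow> bool" where
  "Ck 0 f \<longleftrightarrow> continuous_on UNIV f"
| "Ck (Suc k) f \<longleftrightarrow>
     f differentiable_on UNIV \<and> (\<forall>b\<in>Basis. Ck k (\<lambda>x. frechet_derivative f (at x) b))"

definition smooth :: "('a::euclidean_space \<Rightarrow> 'b::real_normed_vector) \<Rightarrow> bool" where
  "smooth f \<longleftrightarrow> (\<forall>k. Ck k f)"

definition test_function :: "'a::euclidean_space set \<Rightarrow> ('a \<Rightarrow> real) \<Rightarrow> bool" where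
  "test_function \<Omega> \<phi> \<longleftrightarrow>
     smooth \<phi> \<and> compact (closure {x. \<phi> x \<noteq> 0}) \<and> closure {x. \<phi> x \<noteq> 0} \<subseteq> \<Omega>"

text \<open>
  Functions on \<open>\<Omega>\<close> are represented by total functions; their values outside \<open>\<Omega>\<close> and on null
  sets are irrelevant.
\<close>

definition L2 :: "'a::euclidean_space set \<Rightarrow> ('a \<Rightarrow> 'b::euclidean_space) set" where
  "L2 \<Omega> = {f. f \<in> borel_measurable (lebesgue_on \<Omega>) \<and>
              integrable (lebesgue_on \<Omega>) (\<lambda>x. (norm (f x))\<^sup>2)}"

definition l2_inner ::
    "'a::euclidean_space set \<Rightarrow> ('a \<Rightarrow> 'b::euclidean_space) \<Rightarrow> ('a \<Rightarrow> 'b) \<Rightarrow> real" where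
  "l2_inner \<Omega> f g = (\<integral>x. f x \<bullet> g x \<partial>lebesgue_on \<Omega>)"

definition l2_norm :: "'a::euclidean_space set \<Rightarrow> ('a \<Rightarrow> 'b::euclidean_space) \<Rightarrow> real" where
  "l2_norm \<Omega> f = sqrt (l2_inner \<Omega> f f)"

definition l1_norm :: "'a::euclidean_space set \<Rightarrow> ('a \<Rightarrow> real) \<Rightarrow> real" where
  "l1_norm \<Omega> f = (\<integral>x. \<bar>f x\<bar> \<partial>lebesgue_on \<Omega>)"

text \<open>
  \<open>G x $ i $ j\<close> is the weak derivative of the \<open>i\<close>-th component of \<open>u\<close> in direction \<open>j\<close>. The inner
  product of \<open>real ^ 'd ^ 'l\<close> is the Frobenius inner product.
\<close>

definition is_weak_grad ::
    "(real ^ 'd) set \<Rightarrow> (real ^ 'd \<Rightarrow> real ^ 'l) \<Rightarrow> (real ^ 'd \<Rightarrow> real ^ 'd ^ 'l) \<Rightarrow> bool" where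
  "is_weak_grad \<Omega> u G \<longleftrightarrow>
     (\<forall>\<phi> i j. test_function \<Omega> \<phi> \<longrightarrow>
        (\<integral>x. u x $ i * frechet_derivative \<phi> (at x) (axis j 1) \<partial>lebesgue_on \<Omega>) =
        - (\<integral>x. G x $ i $ j * \<phi> x \<partial>lebesgue_on \<Omega>))"

definition H1 :: "(real ^ 'd) set \<Rightarrow> (real ^ 'd \<Rightarrow> real ^ 'l) set" where
  "H1 \<Omega> = {u \<in> L2 \<Omega>. \<exists>G\<in>L2 \<Omega>. is_weak_grad \<Omega> u G}"

definition weak_grad ::
    "(real ^ 'd) set \<Rightarrow> (real ^ 'd \<Rightarrow> real ^ 'l) \<Rightarrow> real ^ 'd \<Rightarrow> real ^ 'd ^ 'l" where
  "weak_grad \<Omega> u = (SOME G. G \<in> L2 \<Omega> \<and> is_weak_grad \<Omega> u G)"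

definition grad_inner ::
    "(real ^ 'd) set \<Rightarrow> (real ^ 'd \<Rightarrow> real ^ 'l) \<Rightarrow> (real ^ 'd \<Rightarrow> real ^ 'l) \<Rightarrow> real" where
  "grad_inner \<Omega> u v = l2_inner \<Omega> (weak_grad \<Omega> u) (weak_grad \<Omega> v)"

definition h1_norm :: "(real ^ 'd) set \<Rightarrow> (real ^ 'd \<Rightarrow> real ^ 'l) \<Rightarrow> real" where
  "h1_norm \<Omega> u = sqrt ((l2_norm \<Omega> u)\<^sup>2 + (l2_norm \<Omega> (weak_grad \<Omega> u))\<^sup>2)"

text \<open>
  The trace operator is the continuous extension of the restriction of smooth functions from
  \<open>H1 \<Omega>\<close> to \<open>L2\<close> of the boundary; \<open>has_trace\<close> is its graph.
\<close>

definition has_trace ::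
    "(real ^ 'd) set \<Rightarrow> (real ^ 'd \<Rightarrow> real ^ 'l) \<Rightarrow> (real ^ 'd \<Rightarrow> real ^ 'l) \<Rightarrow> bool" where
  "has_trace \<Omega> u g \<longleftrightarrow>
     u \<in> H1 \<Omega> \<and> g \<in> borel_measurable (boundary_measure \<Omega>) \<and>
     (\<exists>\<phi> :: nat \<Rightarrow> real ^ 'd \<Rightarrow> real ^ 'l. (\<forall>k. smooth (\<phi> k)) \<and>
        (\<lambda>k. h1_norm \<Omega> (\<lambda>x. \<phi> k x - u x)) \<longlonglongrightarrow> 0 \<and>
        (\<lambda>k. \<integral>\<^sup>+x. ennreal ((norm (\<phi> k x - g x))\<^sup>2) \<partial>boundary_measure \<Omega>) \<longlonglongrightarrow> 0)"

definition trace_on ::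
    "(real ^ 'd) set \<Rightarrow> (real ^ 'd) set \<Rightarrow> (real ^ 'd \<Rightarrow> real ^ 'l) \<Rightarrow> (real ^ 'd \<Rightarrow> real ^ 'l) \<Rightarrow> bool"
  where
  "trace_on \<Omega> \<Gamma> u h \<longleftrightarrow>
     (\<exists>g. has_trace \<Omega> u g \<and> (AE x in boundary_measure \<Omega>. x \<in> \<Gamma> \<longrightarrow> g x = h x))"

definition H1D :: "(real ^ 'd) set \<Rightarrow> (real ^ 'd) set \<Rightarrow> (real ^ 'd \<Rightarrow> real ^ 'l) set" where
  "H1D \<Omega> \<Gamma>\<^sub>D = {v \<in> H1 \<Omega>. trace_on \<Omega> \<Gamma>\<^sub>D v (\<lambda>_. 0)}"

definition dirichlet_part :: "(real ^ 'd) set \<Rightarrow> (real ^ 'd) set \<Rightarrow> bool" where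
  "dirichlet_part \<Omega> \<Gamma>\<^sub>D \<longleftrightarrow>
     \<Gamma>\<^sub>D \<subseteq> frontier \<Omega> \<and> \<Gamma>\<^sub>D \<in> sets (boundary_measure \<Omega>) \<and> emeasure (boundary_measure \<Omega>) \<Gamma>\<^sub>D > 0"

definition unit_length :: "(real ^ 'd) set \<Rightarrow> (real ^ 'd \<Rightarrow> real ^ 'l) \<Rightarrow> bool" where
  "unit_length \<Omega> u \<longleftrightarrow> (AE x in lebesgue_on \<Omega>. norm (u x) = 1)"

definition dirichlet_energy :: "(real ^ 'd) set \<Rightarrow> (real ^ 'd \<Rightarrow> real ^ 'l) \<Rightarrow> real" where
  "dirichlet_energy \<Omega> u = 1/2 * (l2_norm \<Omega> (weak_grad \<Omega> u))\<^sup>2"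

section \<open>The \<open>(\<theta>,\<mu>)\<close>-method\<close>

text \<open>
  Backward difference quotient, meaningful for \<open>n \<ge> 1\<close>; its iterate \<open>dt \<tau> (dt \<tau> u) n\<close> is the
  second difference quotient, meaningful for \<open>n \<ge> 2\<close>.
\<close>

definition dt :: "real \<Rightarrow> (nat \<Rightarrow> 'a \<Rightarrow> 'b::real_vector) \<Rightarrow> nat \<Rightarrow> 'a \<Rightarrow> 'b" where
  "dt \<tau> u n = (\<lambda>x. (u n x - u (n - 1) x) /\<^sub>R \<tau>)"

definition pointwise_orthogonal ::
    "(real ^ 'd) set \<Rightarrow> (real ^ 'd \<Rightarrow> real ^ 'l) \<Rightarrow> (real ^ 'd \<Rightarrow> real ^ 'l) \<Rightarrow> bool" where
  "pointwise_orthogonal \<Omega> v w \<longleftrightarrow> (AE x in lebesgue_on \<Omega>. v x \<bullet> w x = 0)"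

text \<open>
  One linearly constrained step: \<open>d\<close> is the new difference quotient, \<open>w\<close> the previous iterate,
  \<open>\<sigma>\<close> the implicitness parameter, and \<open>uh\<close> the function at which the constraint is linearised.
\<close>

definition constrained_step ::
    "(real ^ 'd) set \<Rightarrow> (real ^ 'd) set \<Rightarrow>
     ((real ^ 'd \<Rightarrow> real ^ 'l) \<Rightarrow> (real ^ 'd \<Rightarrow> real ^ 'l) \<Rightarrow> real) \<Rightarrow> real \<Rightarrow> real \<Rightarrow>
     (real ^ 'd \<Rightarrow> real ^ 'l) \<Rightarrow> (real ^ 'd \<Rightarrow> real ^ 'l) \<Rightarrow> (real ^ 'd \<Rightarrow> real ^ 'l) \<Rightarrow> bool" where
  "constrained_step \<Omega> \<Gamma>\<^sub>D ip \<sigma> \<tau> w uh d \<longleftrightarrow>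
     d \<in> H1D \<Omega> \<Gamma>\<^sub>D \<and> pointwise_orthogonal \<Omega> d uh \<and>
     (\<forall>v \<in> H1D \<Omega> \<Gamma>\<^sub>D. pointwise_orthogonal \<Omega> v uh \<longrightarrow>
        ip d v + grad_inner \<Omega> (\<lambda>x. w x + (\<sigma> * \<tau>) *\<^sub>R d x) v = 0)"

definition theta_mu_method ::
    "(real ^ 'd) set \<Rightarrow> (real ^ 'd) set \<Rightarrow>
     ((real ^ 'd \<Rightarrow> real ^ 'l) \<Rightarrow> (real ^ 'd \<Rightarrow> real ^ 'l) \<Rightarrow> real) \<Rightarrow> real \<Rightarrow> real \<Rightarrow> real \<Rightarrow>
     (real ^ 'd \<Rightarrow> real ^ 'l) \<Rightarrow> (nat \<Rightarrow> real ^ 'd \<Rightarrow> real ^ 'l) \<Rightarrow> bool" where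
  "theta_mu_method \<Omega> \<Gamma>\<^sub>D ip \<theta> \<mu> \<tau> u0 u \<longleftrightarrow>
     u 0 = u0 \<and>
     constrained_step \<Omega> \<Gamma>\<^sub>D ip 1 \<tau> u0 u0 (dt \<tau> u 1) \<and>
     (\<forall>n\<ge>2. constrained_step \<Omega> \<Gamma>\<^sub>D ip \<theta> \<tau> (u (n - 1))
        (\<lambda>x. u (n - 1) x + (\<mu> * \<tau>) *\<^sub>R dt \<tau> u (n - 1) x) (dt \<tau> u n))"

end

(* Since d^n is pointwise orthogonal to u^(n-1) + mu tau d^(n-1), almost everywhere
   |u^n|^2 - |u^(n-1)|^2 = tau^2 (|d^n|^2 - 2 mu d^n . d^(n-1)), with the mixed term absent for n = 1.
   Testing each step with v = d^n bounds tau times the sum of the |d^n|_star^2 by the initial energy,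
   and summing the pointwise identity gives (a). For mu = 1/2 the identity
   2 (|a|^2 - a . b) = |a|^2 - |b|^2 + |a - b|^2 telescopes: |u^m|^2 - 1 is nonnegative and its
   integral is exactly tau^2 / 2 times the quantity in (b).

   The weak gradient is picked by a choice operator, so its linearity needs uniqueness of weak
   derivatives. A function orthogonal to all test functions integrates to zero over every box
   compactly contained in the domain, because products of the flat functions exp (-1/(k t)) are test
   functions that tend to the indicator of the box as k grows; the boxes generate the Borel sets. *)

theory Submission
  imports Defs
begin

section \<open>Smooth bump functions on boxes\<close>

text \<open>Derivatives are unique, so the choice operator in \<open>Ck\<close> may be replaced by
  any derivative computed by the usual rules.\<close>

lemma Ck_SucI:
  assumes "\<And>x. (f has_derivative f' x) (at x)" "\<And>b. b \<in> Basis \<Longrightarrow> Ck k (\<lambda>x. f' x b)"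
  shows "Ck (Suc k) f"
proof -
  have "frechet_derivative f (at x) = f' x" for x
    using assms(1) by (metis frechet_derivative_at)
  then show ?thesis
    using assms by (auto simp: differentiable_on_def intro: differentiableI differentiable_at_withinI)
qed

lemma Ck_Suc_has_derivative:
  "Ck (Suc k) f \<Longrightarrow> (f has_derivative frechet_derivative f (at x)) (at x)"
  by (simp add: differentiable_on_def frechet_derivative_works)

text \<open>Products need this: the Leibniz rule leaves one factor undifferentiated, and the
  induction hypothesis asks only for the lower order of it.\<close>

lemma Ck_Suc_imp_Ck: "Ck (Suc k) f \<Longrightarrow> Ck k f"
proof (induction k arbitrary: f)
  case 0
  then show ?case by (simp add: differentiable_imp_continuous_on)
next
  case (Suc k)
  then show ?case
    using Ck.simps(2) by blast
qed

lemma Ck_const: "Ck k (\<lambda>x. c)"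
proof (induction k arbitrary: c)
  case (Suc k)
  show ?case
    by (rule Ck_SucI[of _ "\<lambda>x h. 0"]) (use Suc in auto)
qed simp

lemma Ck_add: "Ck k f \<Longrightarrow> Ck k g \<Longrightarrow> Ck k (\<lambda>x. f x + g x)"
proof (induction k arbitrary: f g)
  case (Suc k)
  show ?case
    by (rule Ck_SucI[OF has_derivative_add[OF Suc.prems[THEN Ck_Suc_has_derivative]]])
      (use Suc in auto)
qed (simp add: continuous_on_add)

lemma Ck_mult:
  fixes f g :: "'a::euclidean_space \<Rightarrow> real"
  shows "Ck k f \<Longrightarrow> Ck k g \<Longrightarrow> Ck k (\<lambda>x. f x * g x)"
proof (induction k arbitrary: f g)
  case (Suc k)
  show ?case
    by (rule Ck_SucI[OF has_derivative_mult[OF Suc.prems[THEN Ck_Suc_has_derivative]]])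
      (use Suc in \<open>auto intro!: Ck_add Suc.IH Ck_Suc_imp_Ck[OF Suc.prems(1)] Ck_Suc_imp_Ck[OF Suc.prems(2)]\<close>)
qed (simp add: continuous_on_mult)

lemma Ck_prod:
  fixes f :: "'i \<Rightarrow> 'a::euclidean_space \<Rightarrow> real"
  assumes "finite I" "\<And>i. i \<in> I \<Longrightarrow> Ck k (f i)"
  shows "Ck k (\<lambda>x. \<Prod>i\<in>I. f i x)"
  using assms by (induction I rule: finite_induct) (auto intro: Ck_const Ck_mult)

section \<open>Functions that vanish to infinite order at the origin\<close>

text \<open>Under \<open>s = 1/t\<close> this is the decay of \<open>flat_exp\<close> as
  \<open>t\<close> tends to 0 from the right.\<close>

lemma poly_times_exp_minus_tendsto_0: "((\<lambda>s. poly p s * exp (- s)) \<longlongrightarrow> (0::real)) at_top"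
proof -
  have "((\<lambda>s. \<Sum>i\<le>degree p. coeff p i * (s ^ i / exp s)) \<longlongrightarrow> (\<Sum>i\<le>degree p. coeff p i * 0)) at_top"
    by (intro tendsto_sum tendsto_mult tendsto_const tendsto_power_div_exp_0)
  then show ?thesis
    by (simp add: poly_altdef sum_distrib_right exp_minus divide_inverse mult.assoc)
qed

text \<open>The class of these functions is closed under differentiation, hence all of them are smooth.\<close>

definition flat_exp :: "real poly \<Rightarrow> real \<Rightarrow> real" where
  "flat_exp p t = (if t \<le> 0 then 0 else poly p (inverse t) * exp (- inverse t))"

text \<open>With \<open>s = 1/t\<close> one has \<open>ds/dt = - s^2\<close>, so
  \<open>p(s) exp(-s)\<close> has the \<open>t\<close>-derivative
  \<open>s^2 (p(s) - p'(s)) exp(-s)\<close>, and \<open>[:0, 0, 1:]\<close> is the factor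
  \<open>s^2\<close>. Only \<open>t = 0\<close> calls for a limit.\<close>

lemma DERIV_flat_exp:
  "(flat_exp p has_real_derivative flat_exp ([:0, 0, 1:] * (p - pderiv p)) t) (at t)"
proof -
  consider "t < 0" | "t = 0" | "t > 0" by linarith
  then show ?thesis
  proof cases
    case 1
    have "((\<lambda>_. 0) has_real_derivative 0) (at t)" by simp
    then have "(flat_exp p has_real_derivative 0) (at t)"
      by (rule has_field_derivative_transform_within_open[where S = "{..<0}"])
        (use 1 in \<open>auto simp: flat_exp_def\<close>)
    then show ?thesis using 1 by (simp add: flat_exp_def)
  next
    case 2
    have "((\<lambda>h. flat_exp p h / h) \<longlongrightarrow> 0) (at_right 0)"
    proof (rule Lim_transform_eventually)
      \<comment> \<open>Dividing by \<open>h\<close> multiplies by \<open>s = 1/h\<close>, that is,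
        passes from \<open>p\<close> to \<open>pCons 0 p\<close>; the quotient therefore still
        decays.\<close>
      show "((\<lambda>h. poly (pCons 0 p) (inverse h) * exp (- inverse h)) \<longlongrightarrow> 0) (at_right (0::real))"
        by (rule filterlim_compose[OF poly_times_exp_minus_tendsto_0 filterlim_inverse_at_top_right])
      show "\<forall>\<^sub>F h in at_right 0. poly (pCons 0 p) (inverse h) * exp (- inverse h) = flat_exp p h / h"
        using eventually_at_right_less by eventually_elim (simp add: flat_exp_def divide_inverse)
    qed
    moreover have "((\<lambda>h. flat_exp p h / h) \<longlongrightarrow> 0) (at_left 0)"
      by (rule tendsto_eventually, rule eventually_mono[OF eventually_at_left_real[of "-1" 0]])
        (auto simp: flat_exp_def)
    ultimately have "((\<lambda>h. flat_exp p h / h) \<longlongrightarrow> 0) (at 0)"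
      by (simp add: filterlim_split_at)
    then show ?thesis using 2 by (simp add: DERIV_def flat_exp_def)
  next
    case 3
    have "((\<lambda>t. poly p (inverse t) * exp (- inverse t)) has_real_derivative
       flat_exp ([:0, 0, 1:] * (p - pderiv p)) t) (at t)"
      using 3 by (auto intro!: derivative_eq_intros DERIV_chain'[OF _ poly_DERIV]
          simp: flat_exp_def algebra_simps)
    then show ?thesis
      by (rule has_field_derivative_transform_within_open[where S = "{0<..}"])
        (use 3 in \<open>auto simp: flat_exp_def\<close>)
  qed
qed

lemma Ck_flat_exp: "Ck k (\<lambda>x. flat_exp p (x \<bullet> v + c))"
proof (induction k arbitrary: p)
  case 0
  have "continuous_on UNIV (flat_exp p)"
    by (meson DERIV_flat_exp DERIV_isCont continuous_at_imp_continuous_on)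
  then show ?case
    by (auto intro!: continuous_on_compose2[where g = "flat_exp p" and t = UNIV] continuous_on_add
        continuous_on_inner continuous_on_id continuous_on_const)
next
  case (Suc k)
  \<comment> \<open>The chain rule contributes the scalar \<open>h \<bullet> v\<close>. Absorbed
    into the polynomial, it leaves the directional derivative in the form that the induction
    hypothesis covers.\<close>
  let ?q = "\<lambda>h. smult (h \<bullet> v) ([:0, 0, 1:] * (p - pderiv p))"
  have smult: "flat_exp (smult a q) t = flat_exp q t * a" for a q t
    by (simp add: flat_exp_def)
  show ?case
  proof (rule Ck_SucI)
    show "((\<lambda>x. flat_exp p (x \<bullet> v + c)) has_derivative (\<lambda>h. flat_exp (?q h) (x \<bullet> v + c))) (at x)" for x
      unfolding smult
      by (rule has_derivative_compose[OF _ DERIV_flat_exp[unfolded has_field_derivative_def]])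
        (auto intro!: derivative_eq_intros)
  qed (rule Suc)
qed

section \<open>Smooth approximation of indicators of boxes\<close>

text \<open>For \<open>t > 0\<close> the factor \<open>flat_exp 1 (k t)\<close> is
  \<open>exp (-1/(k t))\<close>. Scaling by \<open>k\<close> leaves the support in place and drives
  the values inside to 1.\<close>

definition box_bump :: "'a::euclidean_space \<Rightarrow> 'a \<Rightarrow> nat \<Rightarrow> 'a \<Rightarrow> real" where
  "box_bump a b k x = (\<Prod>i\<in>Basis. flat_exp 1 (real k * (x \<bullet> i - a \<bullet> i)) * flat_exp 1 (real k * (b \<bullet> i - x \<bullet> i)))"

lemma smooth_box_bump: "smooth (box_bump a b k)"
proof -
  have "Ck m (\<lambda>x. flat_exp 1 (real k * (x \<bullet> i - a \<bullet> i)) * flat_exp 1 (real k * (b \<bullet> i - x \<bullet> i)))" for m i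
    using Ck_mult[OF Ck_flat_exp[of m 1 "real k *\<^sub>R i" "- real k * (a \<bullet> i)"]
        Ck_flat_exp[of m 1 "- real k *\<^sub>R i" "real k * (b \<bullet> i)"]]
    by (simp add: algebra_simps)
  then show ?thesis
    unfolding smooth_def box_bump_def by (intro allI Ck_prod) auto
qed

lemma box_bump_bounds: "0 \<le> box_bump a b k x" "box_bump a b k x \<le> 1"
proof -
  have "0 \<le> flat_exp 1 t" "flat_exp 1 t \<le> 1" for t
    by (auto simp: flat_exp_def)
  then show "0 \<le> box_bump a b k x" "box_bump a b k x \<le> 1"
    unfolding box_bump_def by (auto intro!: prod_nonneg prod_le_1 mult_le_one)
qed

lemma box_bump_outside: "x \<notin> box a b \<Longrightarrow> box_bump a b k x = 0"
  by (force simp: box_bump_def mem_box flat_exp_def not_less mult_le_0_iff)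

lemma box_bump_tendsto: "(\<lambda>k. box_bump a b k x) \<longlonglongrightarrow> indicator (box a b) x"
proof (cases "x \<in> box a b")
  case True
  have flat: "(\<lambda>k. flat_exp 1 (real k * t)) \<longlonglongrightarrow> 1" if "t > 0" for t
  proof -
    have "(\<lambda>k. exp (- inverse (real k) * inverse t)) \<longlonglongrightarrow> exp (- 0 * inverse t)"
      by (intro tendsto_intros lim_inverse_n)
    \<comment> \<open>The two sides differ at \<open>k = 0\<close>: there
      \<open>inverse 0 = 0\<close> makes the left side 1, while \<open>flat_exp\<close> is
      0.\<close>
    moreover have "\<forall>\<^sub>F k in sequentially. exp (- inverse (real k) * inverse t) = flat_exp 1 (real k * t)"
      using that by (intro eventually_mono[OF eventually_gt_at_top[of 0]]) (auto simp: flat_exp_def mult_le_0_iff)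
    ultimately show ?thesis by (simp add: Lim_transform_eventually)
  qed
  have "(\<lambda>k. box_bump a b k x) \<longlonglongrightarrow> (\<Prod>i\<in>(Basis::'a set). 1 * 1)"
    unfolding box_bump_def
    using True by (intro tendsto_prod tendsto_mult flat) (auto simp: mem_box)
  with True show ?thesis by simp
next
  case False
  then show ?thesis by (simp add: box_bump_outside)
qed

lemma test_function_box_bump:
  assumes "closure (box a b) \<subseteq> \<Omega>"
  shows "test_function \<Omega> (box_bump a b k)"
proof -
  have "{x. box_bump a b k x \<noteq> 0} \<subseteq> box a b"
    using box_bump_outside by blast
  then have sub: "closure {x. box_bump a b k x \<noteq> 0} \<subseteq> closure (box a b)"
    by (rule closure_mono)
  moreover have "bounded (closure (box a b))" by (rule bounded_closure[OF bounded_box])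
  ultimately show ?thesis
    using assms smooth_box_bump by (auto simp: test_function_def compact_eq_bounded_closed intro: bounded_subset)
qed

lemma smooth_imp_continuous: "smooth \<phi> \<Longrightarrow> continuous_on S \<phi>"
  using Ck.simps(1) continuous_on_subset smooth_def by blast

section \<open>The fundamental lemma of the calculus of variations\<close>

text \<open>Dominated convergence along the bumps of the box, with the bound
  \<open>norm (g x)\<close> because bumps take values in [0, 1].\<close>

lemma integral_box_zero_if_orthogonal:
  fixes g :: "'a::euclidean_space \<Rightarrow> real"
  assumes g: "integrable lebesgue g"
    and orth: "\<And>\<phi>. test_function \<Omega> \<phi> \<Longrightarrow> (\<integral>x. g x * \<phi> x \<partial>lebesgue) = 0"
    and box: "closure (box a b) \<subseteq> \<Omega>"
  shows "(\<integral>x. indicator (box a b) x * g x \<partial>lebesgue) = 0"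
proof -
  have "(\<lambda>k. \<integral>x. g x * box_bump a b k x \<partial>lebesgue) \<longlonglongrightarrow> (\<integral>x. g x * indicator (box a b) x \<partial>lebesgue)"
  proof (rule integral_dominated_convergence)
    show "integrable lebesgue (\<lambda>x. norm (g x))" using g by simp
    show "(\<lambda>x. g x * box_bump a b k x) \<in> borel_measurable lebesgue" for k
      using g borel_measurable_continuous_onI[OF smooth_imp_continuous[OF smooth_box_bump[of a b k]]]
      by (intro borel_measurable_times) (auto intro!: measurable_completion)
    show "(\<lambda>x. g x * indicator (box a b) x) \<in> borel_measurable lebesgue"
      using g by (intro borel_measurable_times) (auto intro!: borel_measurable_indicator)
    show "AE x in lebesgue. (\<lambda>k. g x * box_bump a b k x) \<longlonglongrightarrow> g x * indicator (box a b) x"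
      by (intro AE_I2 tendsto_intros box_bump_tendsto)
    show "AE x in lebesgue. norm (g x * box_bump a b k x) \<le> norm (g x)" for k
      by (intro AE_I2) (simp add: abs_mult mult_left_le box_bump_bounds)
  qed
  moreover have "(\<integral>x. g x * box_bump a b k x \<partial>lebesgue) = 0" for k
    by (intro orth test_function_box_bump box)
  ultimately show ?thesis by (simp add: LIMSEQ_const_iff mult.commute)
qed

text \<open>Boxes are stable under intersection and generate the Borel sets, and the sets over which
  \<open>g\<close> integrates to zero form a Dynkin system; \<open>total\<close> serves the
  complements. An integrable function is determined almost everywhere by its integrals over
  measurable sets.\<close>

lemma AE_zero_if_box_integrals_zero:
  fixes g :: "'a::euclidean_space \<Rightarrow> real"
  assumes g: "integrable lebesgue g"
    and zero: "\<And>a b. (\<integral>x. indicator (box a b) x * g x \<partial>lebesgue) = 0"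
    and total: "(\<integral>x. g x \<partial>lebesgue) = 0"
  shows "AE x in lebesgue. g x = 0"
proof (rule density_unique_real[OF g integrable_zero])
  have int: "integrable lebesgue (\<lambda>x. indicator A x * g x)" if "A \<in> sets lebesgue" for A
    using integrable_mult_indicator[OF that g] by simp
  have borel: "(\<integral>x. indicator A x * g x \<partial>lebesgue) = 0" if "A \<in> sets borel" for A
  proof -
    let ?E = "range (\<lambda>(a, b). box a b :: 'a set)"
    have meas: "B \<in> sets lebesgue" if "B \<in> sigma_sets UNIV ?E" for B
      using that by (intro sets_completionI_sets) (simp add: borel_eq_box)
    have "Int_stable ?E"
      by (auto simp: Int_stable_def box_Int_box)
    moreover have "?E \<subseteq> Pow UNIV" by simp
    moreover have "A \<in> sigma_sets UNIV ?E"
      using that by (simp add: borel_eq_box)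
    ultimately show ?thesis
    proof (induction A rule: sigma_sets_induct_disjoint)
      case (basic A)
      then show ?case using zero by auto
    next
      case empty
      then show ?case by simp
    next
      case (compl A)
      then have A: "A \<in> sets lebesgue" by (intro meas)
      have "(\<integral>x. indicator (UNIV - A) x * g x \<partial>lebesgue) = (\<integral>x. g x - indicator A x * g x \<partial>lebesgue)"
        by (intro Bochner_Integration.integral_cong) (auto simp: indicator_def)
      then show ?case
        using compl.IH total by (simp add: Bochner_Integration.integral_diff[OF g int[OF A]])
    next
      case (union A)
      then have A: "range A \<subseteq> sets lebesgue"
        by (auto intro: meas)
      have "set_integrable lebesgue (\<Union>i. A i) g"
        using int[of "\<Union>i. A i"] A unfolding set_integrable_def by auto
      then have "(LINT x:(\<Union>i. A i)|lebesgue. g x) = (\<Sum>i. LINT x:A i|lebesgue. g x)"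
        using A union by (intro lebesgue_integral_countable_add) (auto simp: disjoint_family_on_def)
      then show ?case using union by (simp add: set_lebesgue_integral_def)
    qed
  qed
  \<comment> \<open>A Lebesgue set is a Borel set up to a subset of a null set, so the Borel case
    suffices.\<close>
  fix A :: "'a set" assume "A \<in> sets lebesgue"
  then obtain S N N' where A: "A = S \<union> N" "N \<subseteq> N'" "N' \<in> null_sets lborel" "S \<in> sets lborel"
    by (rule sets_completionE)
  then have "N' \<in> null_sets lebesgue" by (simp add: null_sets_completionI)
  then have "AE x in lebesgue. indicator A x * g x = indicator S x * g x"
    by (rule AE_I') (use A in \<open>auto simp: indicator_def\<close>)
  moreover have "S \<in> sets lebesgue" using A by (simp add: sets_completionI_sets)
  ultimately have "(\<integral>x. indicator A x * g x \<partial>lebesgue) = (\<integral>x. indicator S x * g x \<partial>lebesgue)"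
    using \<open>A \<in> sets lebesgue\<close> int by (intro integral_cong_AE) auto
  with borel A show "(LINT x:A|lebesgue. g x) = (LINT x:A|lebesgue. 0)"
    by (simp add: set_lebesgue_integral_def)
qed

text \<open>The function is extended by zero to the whole space, shown to vanish on each closed box
  inside the domain up to its boundary, and the boxes are then patched together.\<close>

lemma AE_zero_if_orthogonal_to_test_functions:
  fixes f :: "'a::euclidean_space \<Rightarrow> real"
  assumes \<Omega>: "open \<Omega>"
    and f: "integrable (lebesgue_on \<Omega>) f"
    and orth: "\<And>\<phi>. test_function \<Omega> \<phi> \<Longrightarrow> (\<integral>x. f x * \<phi> x \<partial>lebesgue_on \<Omega>) = 0"
  shows "AE x in lebesgue_on \<Omega>. f x = 0"
proof -
  have \<Omega>_sets: "\<Omega> \<in> sets lebesgue" using \<Omega> by (simp add: borel_open sets_completionI_sets)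
  define g where "g x = indicator \<Omega> x * f x" for x
  have g: "integrable lebesgue g"
    using f \<Omega>_sets by (simp add: g_def[abs_def] integrable_restrict_space)
  have g_orth: "(\<integral>x. g x * \<phi> x \<partial>lebesgue) = 0" if "test_function \<Omega> \<phi>" for \<phi>
    using orth[OF that] \<Omega>_sets by (simp add: g_def integral_restrict_space mult.assoc)
  have local: "AE x in lebesgue. x \<in> box a b \<longrightarrow> g x = 0" if sub: "cbox a b \<subseteq> \<Omega>" for a b
  proof -
    \<comment> \<open>Cutting \<open>g\<close> off to \<open>box a b\<close> makes arbitrary boxes
      admissible: only their intersection with \<open>box a b\<close> matters, which is again a box
      with closure in \<Omega>.\<close>
    have box_integral: "(\<integral>x. indicator (box c d) x * (indicator (box a b) x * g x) \<partial>lebesgue) = 0" for c d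
    proof -
      obtain c' d' where *: "box c d \<inter> box a b = box c' d'"
        by (rule that[OF box_Int_box])
      have "box c' d' \<subseteq> cbox a b"
        by (rule order_trans[OF _ box_subset_cbox]) (simp flip: *)
      then have "closure (box c' d') \<subseteq> \<Omega>"
        by (rule order_trans[OF closure_minimal[OF _ closed_cbox] sub])
      from integral_box_zero_if_orthogonal[OF g g_orth this]
      moreover have "indicator (box c d) x * (indicator (box a b) x * g x) = indicator (box c' d') x * g x" for x
        unfolding *[symmetric] by (simp add: indicator_def)
      ultimately show ?thesis by presburger
    qed
    \<comment> \<open>The integral of the cut-off function over the whole space is its integral over
      \<open>box a b\<close>, hence a case of \<open>box_integral\<close>.\<close>
    have "(\<integral>x. indicator (box a b) x * g x \<partial>lebesgue)
        = (\<integral>x. indicator (box a b) x * (indicator (box a b) x * g x) \<partial>lebesgue)"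
      by (intro Bochner_Integration.integral_cong) (auto simp: indicator_def)
    also have "\<dots> = 0" by (rule box_integral)
    finally have "(\<integral>x. indicator (box a b) x * g x \<partial>lebesgue) = 0" .
    moreover have "integrable lebesgue (\<lambda>x. indicator (box a b) x * g x)"
      using integrable_mult_indicator[OF _ g, of "box a b"] by simp
    ultimately have "AE x in lebesgue. indicator (box a b) x * g x = 0"
      using box_integral by (intro AE_zero_if_box_integrals_zero)
    then show ?thesis by eventually_elim (auto simp: indicator_def)
  qed
  \<comment> \<open>The exceptional null sets can be united only over a countable cover, which
    Lindelof's theorem extracts.\<close>
  define \<B> where "\<B> = {box a b | a b. cbox a b \<subseteq> \<Omega>}"
  obtain \<C> where \<C>: "\<C> \<subseteq> \<B>" "countable \<C>" "\<Union>\<C> = \<Union>\<B>"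
    by (rule Lindelof[of \<B>]) (auto simp: \<B>_def)
  have "\<Omega> \<subseteq> \<Union>\<B>"
  proof
    fix x assume "x \<in> \<Omega>"
    then obtain a b where "x \<in> box a b" "cbox a b \<subseteq> \<Omega>"
      using \<Omega> by (meson open_contains_cbox)
    then show "x \<in> \<Union>\<B>" by (auto simp: \<B>_def)
  qed
  have "AE x in lebesgue. \<forall>B\<in>\<C>. x \<in> B \<longrightarrow> g x = 0"
    using \<C> local by (subst AE_ball_countable) (auto simp: \<B>_def)
  then have "AE x in lebesgue. x \<in> \<Omega> \<longrightarrow> f x = 0"
  proof eventually_elim
    case (elim x)
    show ?case
    proof
      assume "x \<in> \<Omega>"
      then obtain B where "B \<in> \<C>" "x \<in> B" using \<C>(3) \<open>\<Omega> \<subseteq> \<Union>\<B>\<close> by blast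
      with elim \<open>x \<in> \<Omega>\<close> show "f x = 0" by (auto simp: g_def)
    qed
  qed
  then show ?thesis using \<Omega>_sets by (simp add: AE_restrict_space_iff)
qed

section \<open>Linearity of the weak gradient\<close>

lemma L2_integrable_inner:
  assumes "f \<in> L2 \<Omega>" "g \<in> L2 \<Omega>"
  shows "integrable (lebesgue_on \<Omega>) (\<lambda>x. f x \<bullet> g x)"
proof (rule Bochner_Integration.integrable_bound)
  show "integrable (lebesgue_on \<Omega>) (\<lambda>x. (norm (f x))\<^sup>2 + (norm (g x))\<^sup>2)"
    using assms by (simp add: L2_def)
  show "(\<lambda>x. f x \<bullet> g x) \<in> borel_measurable (lebesgue_on \<Omega>)"
    using assms by (auto simp: L2_def intro: borel_measurable_inner)
  have "norm (a \<bullet> b) \<le> norm ((norm a)\<^sup>2 + (norm b)\<^sup>2)" for a b :: 'b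
  proof -
    have "\<bar>a \<bullet> b\<bar> \<le> norm a * norm b" by (rule Cauchy_Schwarz_ineq2)
    moreover have "2 * (norm a * norm b) \<le> (norm a)\<^sup>2 + (norm b)\<^sup>2"
      using zero_le_power2[of "norm a - norm b"] by (simp add: power2_diff)
    moreover have "0 \<le> norm a * norm b" by simp
    ultimately show ?thesis unfolding real_norm_def by linarith
  qed
  then show "AE x in lebesgue_on \<Omega>. norm (f x \<bullet> g x) \<le> norm ((norm (f x))\<^sup>2 + (norm (g x))\<^sup>2)"
    by (intro AE_I2)
qed

lemma L2_scaleR: "f \<in> L2 \<Omega> \<Longrightarrow> (\<lambda>x. c *\<^sub>R f x) \<in> L2 \<Omega>"
  by (auto simp: L2_def power_mult_distrib intro: borel_measurable_scaleR)

lemma L2_add: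
  assumes "f \<in> L2 \<Omega>" "g \<in> L2 \<Omega>"
  shows "(\<lambda>x. f x + g x) \<in> L2 \<Omega>"
proof -
  have "integrable (lebesgue_on \<Omega>) (\<lambda>x. f x \<bullet> f x + f x \<bullet> g x + (g x \<bullet> f x + g x \<bullet> g x))"
    by (intro Bochner_Integration.integrable_add L2_integrable_inner assms)
  moreover have "f x \<bullet> f x + f x \<bullet> g x + (g x \<bullet> f x + g x \<bullet> g x) = (norm (f x + g x))\<^sup>2" for x
    by (simp add: power2_norm_eq_inner inner_add_left inner_add_right)
  ultimately show ?thesis
    using assms by (auto simp: L2_def intro: borel_measurable_add)
qed

lemma L2_component:
  fixes f :: "'a::euclidean_space \<Rightarrow> 'b::euclidean_space ^ 'n"
  assumes "f \<in> L2 \<Omega>"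
  shows "(\<lambda>x. f x $ i) \<in> L2 \<Omega>"
proof -
  have meas: "(\<lambda>x. f x $ i) \<in> borel_measurable (lebesgue_on \<Omega>)"
    using assms
    by (intro measurable_compose[of f _ borel "\<lambda>v. v $ i"] borel_measurable_continuous_onI)
      (auto simp: L2_def intro: continuous_intros)
  have "integrable (lebesgue_on \<Omega>) (\<lambda>x. (norm (f x $ i))\<^sup>2)"
  proof (rule Bochner_Integration.integrable_bound)
    show "integrable (lebesgue_on \<Omega>) (\<lambda>x. (norm (f x))\<^sup>2)"
      using assms by (simp add: L2_def)
    show "AE x in lebesgue_on \<Omega>. norm ((norm (f x $ i))\<^sup>2) \<le> norm ((norm (f x))\<^sup>2)"
      by (intro AE_I2) (simp add: power_mono Finite_Cartesian_Product.norm_nth_le)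
  qed (use meas in simp)
  with meas show ?thesis by (simp add: L2_def)
qed

text \<open>The function is bounded on the compact closure, and the set has finite measure. This
  serves test functions, their derivatives and constants.\<close>

lemma continuous_in_L2:
  fixes \<phi> :: "'a::euclidean_space \<Rightarrow> 'b::euclidean_space"
  assumes "bounded \<Omega>" "\<Omega> \<in> sets lebesgue" "continuous_on UNIV \<phi>"
  shows "\<phi> \<in> L2 \<Omega>"
proof -
  have meas: "\<phi> \<in> borel_measurable (lebesgue_on \<Omega>)"
    using assms(3)
    by (intro measurable_restrict_space1 measurable_completion) (simp add: borel_measurable_continuous_onI)
  have "compact (\<phi> ` closure \<Omega>)"
    using assms by (intro compact_continuous_image) (auto intro: continuous_on_subset simp: compact_closure)
  then obtain B where B: "\<forall>y \<in> \<phi> ` closure \<Omega>. norm y \<le> B"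
    using compact_imp_bounded bounded_iff by metis
  have "finite_measure (lebesgue_on \<Omega>)"
    using assms by (intro finite_measure_lebesgue_on) (simp add: bounded_set_imp_lmeasurable)
  then have "integrable (lebesgue_on \<Omega>) (\<lambda>x. (norm (\<phi> x))\<^sup>2)"
  proof (rule finite_measure.integrable_const_bound)
    show "AE x in lebesgue_on \<Omega>. norm ((norm (\<phi> x))\<^sup>2) \<le> B\<^sup>2"
      using B closure_subset[of \<Omega>] assms(2) by (intro AE_I2) (force intro!: power_mono)
  qed (use meas in simp)
  with meas show ?thesis by (simp add: L2_def)
qed

lemma l2_inner_commute: "l2_inner \<Omega> f g = l2_inner \<Omega> g f"
  by (simp add: l2_inner_def inner_commute)

lemma l2_inner_self: "l2_inner \<Omega> f f = (\<integral>x. (norm (f x))\<^sup>2 \<partial>lebesgue_on \<Omega>)"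
  by (simp add: l2_inner_def power2_norm_eq_inner)

lemma l2_inner_self_nonneg: "0 \<le> l2_inner \<Omega> f f"
  by (simp add: l2_inner_self)

lemma l2_norm_sq: "(l2_norm \<Omega> f)\<^sup>2 = l2_inner \<Omega> f f"
  by (simp add: l2_norm_def l2_inner_self_nonneg)

text \<open>The combination \<open>f + c g\<close> is the shape of every update of the iteration, so
  linearity is stated in this form throughout.\<close>

lemma l2_inner_add_scaleR:
  assumes "f \<in> L2 \<Omega>" "g \<in> L2 \<Omega>" "h \<in> L2 \<Omega>"
  shows "l2_inner \<Omega> (\<lambda>x. f x + c *\<^sub>R g x) h = l2_inner \<Omega> f h + c * l2_inner \<Omega> g h"
  using L2_integrable_inner[OF assms(1,3)] L2_integrable_inner[OF assms(2,3)]
  by (simp add: l2_inner_def inner_add_left)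

lemma l2_inner_cong_AE:
  assumes "AE x in lebesgue_on \<Omega>. f x = f' x" "f \<in> L2 \<Omega>" "f' \<in> L2 \<Omega>" "g \<in> L2 \<Omega>"
  shows "l2_inner \<Omega> f g = l2_inner \<Omega> f' g"
  unfolding l2_inner_def
  by (rule integral_cong_AE) (use assms in \<open>auto simp: L2_def\<close>)

lemma test_function_derivative_continuous:
  fixes \<phi> :: "real ^ 'd \<Rightarrow> real"
  assumes "test_function \<Omega> \<phi>"
  shows "continuous_on UNIV (\<lambda>x. frechet_derivative \<phi> (at x) (axis j 1))"
proof -
  have "Ck (Suc 0) \<phi>" using assms unfolding test_function_def smooth_def by blast
  moreover have "axis j 1 \<in> (Basis :: (real ^ 'd) set)" by (simp add: axis_in_Basis_iff)
  ultimately show ?thesis by simp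
qed

section \<open>Weak gradients on bounded open sets\<close>

text \<open>Openness gives uniqueness of weak gradients; boundedness puts test functions and
  constants into \<open>L2\<close>.\<close>

locale bounded_open =
  fixes \<Omega> :: "(real ^ 'd) set"
  assumes open_dom: "open \<Omega>" and bounded_dom: "bounded \<Omega>"
begin

lemma dom_sets: "\<Omega> \<in> sets lebesgue"
  using open_dom by (simp add: borel_open sets_completionI_sets)

lemma test_function_L2:
  assumes "test_function \<Omega> \<phi>"
  shows "\<phi> \<in> L2 \<Omega>" "(\<lambda>x. frechet_derivative \<phi> (at x) (axis j 1)) \<in> L2 \<Omega>"
  using assms test_function_derivative_continuous[OF assms] smooth_imp_continuous[of \<phi>]
  by (auto intro!: continuous_in_L2 bounded_dom dom_sets simp: test_function_def)

lemma integrable_component_times: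
  fixes u :: "real ^ 'd \<Rightarrow> real ^ 'n"
  assumes "u \<in> L2 \<Omega>" "\<psi> \<in> L2 \<Omega>"
  shows "integrable (lebesgue_on \<Omega>) (\<lambda>x. u x $ i * \<psi> x)"
  using L2_integrable_inner[OF L2_component[OF assms(1), of i] assms(2)] by simp

text \<open>Both sides of the defining identity are linear once the integrals can be split. The
  \<open>L2\<close> assumptions provide this, since the integral of a non-integrable function is 0
  by default.\<close>

lemma is_weak_grad_add_scaleR:
  assumes "u \<in> L2 \<Omega>" "v \<in> L2 \<Omega>" "G \<in> L2 \<Omega>" "K \<in> L2 \<Omega>"
    and "is_weak_grad \<Omega> u G" "is_weak_grad \<Omega> v K"
  shows "is_weak_grad \<Omega> (\<lambda>x. u x + c *\<^sub>R v x) (\<lambda>x. G x + c *\<^sub>R K x)"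
  unfolding is_weak_grad_def
proof (intro allI impI)
  fix \<phi> i j assume \<phi>: "test_function \<Omega> \<phi>"
  let ?D = "\<lambda>x. frechet_derivative \<phi> (at x) (axis j 1)"
  note L2 = test_function_L2[OF \<phi>]
  have "(\<integral>x. (u x + c *\<^sub>R v x) $ i * ?D x \<partial>lebesgue_on \<Omega>)
      = (\<integral>x. u x $ i * ?D x + c * (v x $ i * ?D x) \<partial>lebesgue_on \<Omega>)"
    by (simp add: algebra_simps)
  also have "\<dots> = (\<integral>x. u x $ i * ?D x \<partial>lebesgue_on \<Omega>) + c * (\<integral>x. v x $ i * ?D x \<partial>lebesgue_on \<Omega>)"
    using assms(1,2)[THEN integrable_component_times[OF _ L2(2)]] by simp
  also have "\<dots> = - ((\<integral>x. G x $ i $ j * \<phi> x \<partial>lebesgue_on \<Omega>) + c * (\<integral>x. K x $ i $ j * \<phi> x \<partial>lebesgue_on \<Omega>))"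
    using assms(5,6) \<phi> by (simp add: is_weak_grad_def)
  also have "\<dots> = - (\<integral>x. G x $ i $ j * \<phi> x + c * (K x $ i $ j * \<phi> x) \<partial>lebesgue_on \<Omega>)"
    using assms(3,4)[THEN L2_component, THEN integrable_component_times[OF _ L2(1)]] by simp
  also have "\<dots> = - (\<integral>x. (G x + c *\<^sub>R K x) $ i $ j * \<phi> x \<partial>lebesgue_on \<Omega>)"
    by (simp add: algebra_simps)
  finally show "(\<integral>x. (u x + c *\<^sub>R v x) $ i * ?D x \<partial>lebesgue_on \<Omega>)
      = - (\<integral>x. (G x + c *\<^sub>R K x) $ i $ j * \<phi> x \<partial>lebesgue_on \<Omega>)" .
qed

lemma is_weak_grad_unique:
  assumes G: "G \<in> L2 \<Omega>" "is_weak_grad \<Omega> u G" and K: "K \<in> L2 \<Omega>" "is_weak_grad \<Omega> u K"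
  shows "AE x in lebesgue_on \<Omega>. G x = K x"
proof -
  have "AE x in lebesgue_on \<Omega>. G x $ i $ j - K x $ i $ j = 0" for i j
  proof (rule AE_zero_if_orthogonal_to_test_functions[OF open_dom])
    note comp = G(1)[THEN L2_component[where i = i]] K(1)[THEN L2_component[where i = i]]
    \<comment> \<open>Pairing with the constant 1 turns square-integrability into the integrability
      that the fundamental lemma asks for.\<close>
    have "(\<lambda>x. 1) \<in> L2 \<Omega>"
      by (intro continuous_in_L2 bounded_dom dom_sets continuous_on_const)
    from comp[THEN integrable_component_times[OF _ this, where i = j]]
    show "integrable (lebesgue_on \<Omega>) (\<lambda>x. G x $ i $ j - K x $ i $ j)"
      by simp
    fix \<phi> assume \<phi>: "test_function \<Omega> \<phi>"
    show "(\<integral>x. (G x $ i $ j - K x $ i $ j) * \<phi> x \<partial>lebesgue_on \<Omega>) = 0"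
      using G(2) K(2) \<phi> comp[THEN integrable_component_times[OF _ test_function_L2(1)[OF \<phi>], where i = j]]
      by (simp add: is_weak_grad_def left_diff_distrib)
  qed
  then have "AE x in lebesgue_on \<Omega>. \<forall>i j. G x $ i $ j - K x $ i $ j = 0"
    by (simp add: AE_all_countable)
  then show ?thesis by eventually_elim (simp add: vec_eq_iff)
qed

lemma weak_grad:
  assumes "u \<in> H1 \<Omega>"
  shows "weak_grad \<Omega> u \<in> L2 \<Omega>" "is_weak_grad \<Omega> u (weak_grad \<Omega> u)"
proof -
  have "weak_grad \<Omega> u \<in> L2 \<Omega> \<and> is_weak_grad \<Omega> u (weak_grad \<Omega> u)"
    unfolding weak_grad_def by (rule someI_ex[of "\<lambda>G. G \<in> L2 \<Omega> \<and> is_weak_grad \<Omega> u G"]) (use assms in \<open>auto simp: H1_def\<close>)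
  then show "weak_grad \<Omega> u \<in> L2 \<Omega>" "is_weak_grad \<Omega> u (weak_grad \<Omega> u)" by blast+
qed

lemma H1_L2: "u \<in> H1 \<Omega> \<Longrightarrow> u \<in> L2 \<Omega>"
  by (simp add: H1_def)

lemma H1_add_scaleR:
  assumes "u \<in> H1 \<Omega>" "v \<in> H1 \<Omega>"
  shows "(\<lambda>x. u x + c *\<^sub>R v x) \<in> H1 \<Omega>"
proof -
  have "(\<lambda>x. u x + c *\<^sub>R v x) \<in> L2 \<Omega>"
    by (intro L2_add L2_scaleR H1_L2 assms)
  moreover have "(\<lambda>x. weak_grad \<Omega> u x + c *\<^sub>R weak_grad \<Omega> v x) \<in> L2 \<Omega>"
    by (intro L2_add L2_scaleR weak_grad assms)
  moreover have "is_weak_grad \<Omega> (\<lambda>x. u x + c *\<^sub>R v x) (\<lambda>x. weak_grad \<Omega> u x + c *\<^sub>R weak_grad \<Omega> v x)"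
    by (intro is_weak_grad_add_scaleR weak_grad H1_L2 assms)
  ultimately show ?thesis unfolding H1_def by blast
qed

text \<open>Both sides are weak gradients of the same function, so uniqueness identifies the chosen
  one with the linear combination.\<close>

lemma weak_grad_add_scaleR:
  assumes "u \<in> H1 \<Omega>" "v \<in> H1 \<Omega>"
  shows "AE x in lebesgue_on \<Omega>.
    weak_grad \<Omega> (\<lambda>x. u x + c *\<^sub>R v x) x = weak_grad \<Omega> u x + c *\<^sub>R weak_grad \<Omega> v x"
  using assms
  by (intro is_weak_grad_unique[of _ "\<lambda>x. u x + c *\<^sub>R v x"] is_weak_grad_add_scaleR L2_add L2_scaleR
      weak_grad H1_add_scaleR H1_L2)

lemma grad_inner_add_scaleR:
  assumes "u \<in> H1 \<Omega>" "v \<in> H1 \<Omega>" "w \<in> H1 \<Omega>"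
  shows "grad_inner \<Omega> (\<lambda>x. u x + c *\<^sub>R v x) w = grad_inner \<Omega> u w + c * grad_inner \<Omega> v w"
  using assms unfolding grad_inner_def
  by (subst l2_inner_cong_AE[OF weak_grad_add_scaleR])
    (simp_all add: l2_inner_add_scaleR weak_grad H1_add_scaleR L2_add L2_scaleR)

end

lemma grad_inner_commute: "grad_inner \<Omega> u v = grad_inner \<Omega> v u"
  unfolding grad_inner_def by (rule l2_inner_commute)

section \<open>Energy and constraint error of the iteration\<close>

text \<open>A single run with a fixed step size. The estimates below carry explicit constants, so
  their uniformity in \<tau> and \<open>m\<close> can be read off.\<close>

locale theta_mu_iteration = bounded_open \<Omega> for \<Omega> :: "(real ^ 'd) set" +
  fixes \<Gamma>\<^sub>D :: "(real ^ 'd) set"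
    and ip :: "(real ^ 'd \<Rightarrow> real ^ 'l) \<Rightarrow> (real ^ 'd \<Rightarrow> real ^ 'l) \<Rightarrow> real"
    and cs \<theta> \<mu> \<tau> :: real and u0 :: "real ^ 'd \<Rightarrow> real ^ 'l" and u :: "nat \<Rightarrow> real ^ 'd \<Rightarrow> real ^ 'l"
  assumes ip: "ip = l2_inner \<Omega> \<or> ip = grad_inner \<Omega>"
    and cs: "cs > 0"
    and poincare: "\<And>v. v \<in> H1D \<Omega> \<Gamma>\<^sub>D \<Longrightarrow> l2_norm \<Omega> v \<le> sqrt cs * sqrt (ip v v)"
    and theta: "1/2 \<le> \<theta>" and mu: "0 \<le> \<mu>" "\<mu> \<le> 1" and tau: "\<tau> > 0"
    and u0: "u0 \<in> H1 \<Omega>" "unit_length \<Omega> u0"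
    and generated: "theta_mu_method \<Omega> \<Gamma>\<^sub>D ip \<theta> \<mu> \<tau> u0 u"
begin

abbreviation d :: "nat \<Rightarrow> real ^ 'd \<Rightarrow> real ^ 'l" where "d \<equiv> dt \<tau> u"

lemma u_0: "u 0 = u0"
  using generated by (simp add: theta_mu_method_def)

lemma u_Suc: "u (Suc n) = (\<lambda>x. u n x + \<tau> *\<^sub>R d (Suc n) x)"
  using tau by (simp add: dt_def)

lemma step_1: "constrained_step \<Omega> \<Gamma>\<^sub>D ip 1 \<tau> u0 u0 (d 1)"
  using generated by (simp add: theta_mu_method_def)

lemma step_Suc_Suc:
  "constrained_step \<Omega> \<Gamma>\<^sub>D ip \<theta> \<tau> (u (Suc n)) (\<lambda>x. u (Suc n) x + (\<mu> * \<tau>) *\<^sub>R d (Suc n) x) (d (Suc (Suc n)))"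
proof -
  have "2 \<le> Suc (Suc n)" by simp
  then show ?thesis using generated unfolding theta_mu_method_def by (metis diff_Suc_1)
qed

text \<open>Treats the initial Euler step and the later steps alike: the energy argument uses of the
  implicitness parameter only that it is at least 1/2.\<close>

lemma step: "\<exists>\<sigma>\<ge>1/2. \<exists>w. constrained_step \<Omega> \<Gamma>\<^sub>D ip \<sigma> \<tau> (u n) w (d (Suc n))"
proof (cases n)
  case 0
  then show ?thesis using step_1 by (auto simp: u_0 intro!: exI[of _ 1])
next
  case (Suc k)
  then show ?thesis using step_Suc_Suc theta by blast
qed

lemma d_H1D: "d (Suc n) \<in> H1D \<Omega> \<Gamma>\<^sub>D"
  using step[of n] by (auto simp: constrained_step_def)

lemma d_H1: "d (Suc n) \<in> H1 \<Omega>"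
  using d_H1D[of n] by (simp add: H1D_def)

lemma u_H1: "u n \<in> H1 \<Omega>"
proof (induction n)
  case (Suc n)
  show ?case unfolding u_Suc[of n] by (intro H1_add_scaleR Suc d_H1)
qed (simp add: u_0 u0)

text \<open>The increment satisfies its own constraint, so it is an admissible test function.
  Inserting the result into the expansion \<open>a + 2 \<tau> b + \<tau>^2 e\<close> of the new
  gradient term leaves the remainder \<open>\<tau>^2 (1 - 2 \<sigma>) e\<close>, which is
  nonpositive.\<close>

lemma energy_step:
  "grad_inner \<Omega> (u (Suc n)) (u (Suc n)) + 2 * \<tau> * ip (d (Suc n)) (d (Suc n)) \<le> grad_inner \<Omega> (u n) (u n)"
proof -
  let ?d = "d (Suc n)"
  define a b e where "a = grad_inner \<Omega> (u n) (u n)" and "b = grad_inner \<Omega> (u n) ?d"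
    and "e = grad_inner \<Omega> ?d ?d"
  note add = grad_inner_add_scaleR[OF u_H1 d_H1]
  obtain \<sigma> w where \<sigma>: "1/2 \<le> \<sigma>" and "constrained_step \<Omega> \<Gamma>\<^sub>D ip \<sigma> \<tau> (u n) w ?d"
    using step by blast
  then have "ip ?d ?d + grad_inner \<Omega> (\<lambda>x. u n x + (\<sigma> * \<tau>) *\<^sub>R ?d x) ?d = 0"
    unfolding constrained_step_def by blast
  then have test: "ip ?d ?d = - (b + \<sigma> * \<tau> * e)"
    by (simp add: add d_H1 b_def e_def)
  have "grad_inner \<Omega> (u (Suc n)) (u n) = a + \<tau> * b"
    by (simp add: u_Suc[of n] add u_H1 a_def b_def grad_inner_commute[of _ ?d])
  moreover have "grad_inner \<Omega> (u (Suc n)) ?d = b + \<tau> * e"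
    by (subst u_Suc) (simp add: add d_H1 b_def e_def)
  moreover have "grad_inner \<Omega> (u (Suc n)) (u (Suc n))
      = grad_inner \<Omega> (u (Suc n)) (u n) + \<tau> * grad_inner \<Omega> (u (Suc n)) ?d"
    by (subst u_Suc) (simp only: add[OF u_H1] grad_inner_commute[of _ "u (Suc n)"])
  ultimately have "grad_inner \<Omega> (u (Suc n)) (u (Suc n)) = a + 2 * \<tau> * b + \<tau>\<^sup>2 * e"
    by (simp add: algebra_simps power2_eq_square)
  moreover have "e \<ge> 0"
    unfolding e_def grad_inner_def by (rule l2_inner_self_nonneg)
  then have "\<tau>\<^sup>2 * e * (1/2) \<le> \<tau>\<^sup>2 * e * \<sigma>"
    using \<sigma> by (intro mult_left_mono) auto
  ultimately show ?thesis
    unfolding test a_def[symmetric] by (simp add: algebra_simps power2_eq_square)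
qed

text \<open>\<open>energy_step\<close> telescopes, the final gradient term is dropped, and the 1/2
  in \<open>dirichlet_energy\<close> absorbs the factor 2.\<close>

lemma dissipation_bound: "\<tau> * (\<Sum>n=1..m. ip (d n) (d n)) \<le> dirichlet_energy \<Omega> u0"
proof -
  have "grad_inner \<Omega> (u m) (u m) + 2 * \<tau> * (\<Sum>n=1..m. ip (d n) (d n)) \<le> grad_inner \<Omega> u0 u0"
  proof (induction m)
    case (Suc m)
    then show ?case using energy_step[of m] by (simp add: distrib_left)
  qed (simp add: u_0)
  moreover have "0 \<le> grad_inner \<Omega> (u m) (u m)"
    unfolding grad_inner_def by (rule l2_inner_self_nonneg)
  ultimately show ?thesis
    by (simp add: dirichlet_energy_def l2_norm_sq grad_inner_def)
qed

section \<open>The error in the unit-length constraint\<close>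

text \<open>Squaring \<open>poincare\<close> removes the roots because both choices of
  \<open>ip\<close> are nonnegative on the diagonal.\<close>

lemma l2_le_ip: "l2_inner \<Omega> (d (Suc n)) (d (Suc n)) \<le> cs * ip (d (Suc n)) (d (Suc n))"
proof -
  let ?d = "d (Suc n)"
  have "(l2_norm \<Omega> ?d)\<^sup>2 \<le> (sqrt cs * sqrt (ip ?d ?d))\<^sup>2"
    using poincare[OF d_H1D, of n]
    by (intro power_mono) (auto simp: l2_norm_def l2_inner_self_nonneg)
  also have "\<dots> = cs * ip ?d ?d"
    using cs ip by (auto simp: power_mult_distrib grad_inner_def l2_inner_self_nonneg)
  finally show ?thesis by (simp add: l2_norm_sq)
qed

text \<open>In the expansion of \<open>|u + \<tau> d|^2\<close> the linear term vanishes in the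
  first step, and the linearised constraint turns it into the mixed product later. The quantifier
  over \<open>n\<close> stands inside \<open>AE\<close>, so that inductions on \<open>n\<close> can
  run at one fixed point.\<close>

lemma constraint_recursion:
  "AE x in lebesgue_on \<Omega>. (norm (u 1 x))\<^sup>2 - 1 = \<tau>\<^sup>2 * (norm (d 1 x))\<^sup>2 \<and>
     (\<forall>n. (norm (u (Suc (Suc n)) x))\<^sup>2 = (norm (u (Suc n) x))\<^sup>2
        + \<tau>\<^sup>2 * ((norm (d (Suc (Suc n)) x))\<^sup>2 - 2 * \<mu> * (d (Suc (Suc n)) x \<bullet> d (Suc n) x)))"
proof -
  have expand: "(norm (u (Suc n) x))\<^sup>2
      = (norm (u n x))\<^sup>2 + 2 * \<tau> * (d (Suc n) x \<bullet> u n x) + \<tau>\<^sup>2 * (norm (d (Suc n) x))\<^sup>2" for n x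
    unfolding u_Suc[of n] power2_norm_eq_inner
    by (simp add: inner_add_left inner_add_right inner_commute power2_eq_square algebra_simps)
  have "AE x in lebesgue_on \<Omega>. norm (u0 x) = 1"
    using u0 by (simp add: unit_length_def)
  moreover have "AE x in lebesgue_on \<Omega>. d 1 x \<bullet> u0 x = 0"
    using step_1 by (simp add: constrained_step_def pointwise_orthogonal_def)
  moreover have "AE x in lebesgue_on \<Omega>. \<forall>n. d (Suc (Suc n)) x \<bullet> (u (Suc n) x + (\<mu> * \<tau>) *\<^sub>R d (Suc n) x) = 0"
    using step_Suc_Suc by (simp add: constrained_step_def pointwise_orthogonal_def AE_all_countable)
  ultimately show ?thesis
  proof eventually_elim
    case (elim x)
    have "d (Suc (Suc n)) x \<bullet> u (Suc n) x = - \<mu> * \<tau> * (d (Suc (Suc n)) x \<bullet> d (Suc n) x)" for n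
      using elim(3)[rule_format, of n] by (simp add: inner_add_right)
    then show ?case
      using elim expand[of 0 x] expand[of "Suc _" x]
      by (simp add: u_0 power2_eq_square algebra_simps)
  qed
qed

lemma u_norm_integrable: "integrable (lebesgue_on \<Omega>) (\<lambda>x. \<bar>(norm (u n x))\<^sup>2 - 1\<bar>)"
proof -
  have "(\<lambda>x. 1 :: real) \<in> L2 \<Omega>"
    by (intro continuous_in_L2 bounded_dom dom_sets continuous_on_const)
  then show ?thesis
    using H1_L2[OF u_H1[of n]] by (simp add: L2_def)
qed

lemma d_norm_integrable: "integrable (lebesgue_on \<Omega>) (\<lambda>x. (norm (d (Suc n) x))\<^sup>2)"
  using H1_L2[OF d_H1[of n]] by (simp add: L2_def)

lemma constraint_error_linear:
  assumes "m \<ge> 1"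
  shows "l1_norm \<Omega> (\<lambda>x. (norm (u m x))\<^sup>2 - 1) \<le> 3 * cs * dirichlet_energy \<Omega> u0 * \<tau>"
proof -
  have "AE x in lebesgue_on \<Omega>. \<bar>(norm (u m x))\<^sup>2 - 1\<bar> \<le> 3 * \<tau>\<^sup>2 * (\<Sum>n=1..m. (norm (d n x))\<^sup>2)"
    using constraint_recursion
  proof eventually_elim
    case (elim x)
    \<comment> \<open>The subtracted square is a reserve for the induction: the next step adds at
      most \<open>2 p^2 + q^2\<close>, the reserve pays for \<open>q^2\<close>, and of the new
      \<open>3 p^2\<close> one \<open>p^2\<close> is kept back.\<close>
    have "\<bar>(norm (u m x))\<^sup>2 - 1\<bar> \<le> \<tau>\<^sup>2 * (3 * (\<Sum>n=1..m. (norm (d n x))\<^sup>2) - (norm (d m x))\<^sup>2)"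
      using assms
    proof (induction m rule: dec_induct)
      case base
      then show ?case using elim by simp
    next
      case (step m)
      then obtain k where k: "m = Suc k" by (cases m) auto
      define p q r where "p = norm (d (Suc m) x)" and "q = norm (d m x)" and "r = d (Suc m) x \<bullet> d m x"
      have "\<bar>r\<bar> \<le> p * q" unfolding p_def q_def r_def by (rule Cauchy_Schwarz_ineq2)
      moreover have "2 * (p * q) \<le> p\<^sup>2 + q\<^sup>2"
        using zero_le_power2[of "p - q"] by (simp add: power2_diff)
      moreover have "\<bar>\<mu> * r\<bar> \<le> 1 * \<bar>r\<bar>" unfolding abs_mult using mu by (intro mult_right_mono) auto
      ultimately have "\<bar>p\<^sup>2 - 2 * \<mu> * r\<bar> \<le> 2 * p\<^sup>2 + q\<^sup>2"
        using zero_le_power2[of p] by (simp only: mult.assoc abs_le_iff) linarith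
      then have "\<bar>\<tau>\<^sup>2 * (p\<^sup>2 - 2 * \<mu> * r)\<bar> \<le> \<tau>\<^sup>2 * (2 * p\<^sup>2 + q\<^sup>2)"
        by (simp add: abs_mult mult_left_mono)
      moreover have "(norm (u (Suc m) x))\<^sup>2 = (norm (u m x))\<^sup>2 + \<tau>\<^sup>2 * (p\<^sup>2 - 2 * \<mu> * r)"
        using elim k by (simp add: p_def r_def)
      ultimately show ?case
        using step.IH by (simp add: algebra_simps flip: p_def q_def)
    qed
    also have "\<dots> \<le> 3 * \<tau>\<^sup>2 * (\<Sum>n=1..m. (norm (d n x))\<^sup>2)"
      by (simp add: algebra_simps)
    finally show ?case .
  qed
  moreover have int: "integrable (lebesgue_on \<Omega>) (\<lambda>x. (norm (d n x))\<^sup>2)" if "n \<in> {1..m}" for n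
    using that d_norm_integrable[of "n - 1"] by simp
  ultimately have "l1_norm \<Omega> (\<lambda>x. (norm (u m x))\<^sup>2 - 1)
      \<le> (\<integral>x. 3 * \<tau>\<^sup>2 * (\<Sum>n=1..m. (norm (d n x))\<^sup>2) \<partial>lebesgue_on \<Omega>)"
    unfolding l1_norm_def
    by (intro integral_mono_AE u_norm_integrable integrable_mult_right Bochner_Integration.integrable_sum)
  also have "\<dots> = 3 * \<tau>\<^sup>2 * (\<Sum>n=1..m. l2_inner \<Omega> (d n) (d n))"
    using int by (simp add: l2_inner_self)
  also have "\<dots> \<le> 3 * \<tau>\<^sup>2 * (\<Sum>n=1..m. cs * ip (d n) (d n))"
  proof (intro mult_left_mono sum_mono)
    fix n assume "n \<in> {1..m}"
    then show "l2_inner \<Omega> (d n) (d n) \<le> cs * ip (d n) (d n)"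
      using l2_le_ip[of "n - 1"] by simp
  qed simp
  \<comment> \<open>One factor \<tau> joins the sum to form the dissipation, which the energy
    bounds; the other is the claimed rate.\<close>
  also have "\<dots> = 3 * cs * \<tau> * (\<tau> * (\<Sum>n=1..m. ip (d n) (d n)))"
    by (simp add: power2_eq_square flip: sum_distrib_left)
  also have "\<dots> \<le> 3 * cs * \<tau> * dirichlet_energy \<Omega> u0"
    using cs tau by (intro mult_left_mono dissipation_bound) auto
  finally show ?thesis by (simp add: mult_ac)
qed

lemma constraint_error_quadratic:
  assumes "\<mu> = 1/2" "m \<ge> 1"
  shows "l1_norm \<Omega> (\<lambda>x. (norm (u m x))\<^sup>2 - 1) =
    ((l2_norm \<Omega> (d m))\<^sup>2 + (l2_norm \<Omega> (d 1))\<^sup>2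
       + \<tau>\<^sup>2 * (\<Sum>n=2..m. (l2_norm \<Omega> (dt \<tau> d n))\<^sup>2)) / 2 * \<tau>\<^sup>2"
proof -
  let ?S = "\<lambda>m x. (norm (d m x))\<^sup>2 + (norm (d 1 x))\<^sup>2 + \<tau>\<^sup>2 * (\<Sum>n=2..m. (norm (dt \<tau> d n x))\<^sup>2)"
  have nonneg: "0 \<le> ?S m x" for x
    by (intro add_nonneg_nonneg mult_nonneg_nonneg sum_nonneg) auto
  \<comment> \<open>Expresses the mixed product of consecutive increments through their second
    difference quotient.\<close>
  have second: "\<tau>\<^sup>2 * (norm (dt \<tau> d (Suc n) x))\<^sup>2 = (norm (d (Suc n) x))\<^sup>2 + (norm (d n x))\<^sup>2 - 2 * (d (Suc n) x \<bullet> d n x)"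
    for n x
  proof -
    have "\<tau>\<^sup>2 * (norm (dt \<tau> d (Suc n) x))\<^sup>2 = (norm (\<tau> *\<^sub>R dt \<tau> d (Suc n) x))\<^sup>2"
      by (simp add: power_mult_distrib)
    also have "\<tau> *\<^sub>R dt \<tau> d (Suc n) x = d (Suc n) x - d n x"
      using tau by (simp add: dt_def[of \<tau> d])
    finally show ?thesis
      by (simp add: power2_norm_eq_inner inner_diff_left inner_diff_right inner_commute)
  qed
  have "AE x in lebesgue_on \<Omega>. \<bar>(norm (u m x))\<^sup>2 - 1\<bar> = \<tau>\<^sup>2 / 2 * ?S m x"
    using constraint_recursion
  proof eventually_elim
    case (elim x)
    have "(norm (u m x))\<^sup>2 - 1 = \<tau>\<^sup>2 / 2 * ?S m x"
      using assms(2)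
    proof (induction m rule: dec_induct)
      \<comment> \<open>For \<open>m = 1\<close> the sum is empty and \<open>?S\<close> counts the
        square of \<open>d 1\<close> twice, which cancels the 1/2. This is the origin of the
        separate \<open>d 1\<close> term.\<close>
      case base
      then show ?case using elim by simp
    next
      case (step m)
      then obtain k where k: "m = Suc k" by (cases m) auto
      have "(norm (u (Suc m) x))\<^sup>2 - 1 = ((norm (u m x))\<^sup>2 - 1)
          + \<tau>\<^sup>2 * ((norm (d (Suc m) x))\<^sup>2 - d (Suc m) x \<bullet> d m x)"
        using elim assms(1) k by simp
      \<comment> \<open>The old square \<open>(norm (d m x))^2\<close> cancels against the one in
        \<open>?S m x\<close>, the new one takes its place, and the sum gains one term.\<close>
      also have "\<dots> = \<tau>\<^sup>2 / 2 * (?S m x + (norm (d (Suc m) x))\<^sup>2 - (norm (d m x))\<^sup>2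
          + \<tau>\<^sup>2 * (norm (dt \<tau> d (Suc m) x))\<^sup>2)"
        unfolding step.IH second by (simp add: field_simps)
      also have "\<dots> = \<tau>\<^sup>2 / 2 * ?S (Suc m) x"
        using step.hyps by (simp add: distrib_left)
      finally show ?case .
    qed
    moreover have "0 \<le> \<tau>\<^sup>2 / 2 * ?S m x"
      using nonneg by (intro mult_nonneg_nonneg) auto
    ultimately show ?case by (simp only: abs_of_nonneg)
  qed
  moreover have dL2: "d n \<in> L2 \<Omega>" if "n \<ge> 1" for n
    using H1_L2[OF d_H1[of "n - 1"]] that by simp
  \<comment> \<open>From \<open>n = 2\<close> on, both increments in the second difference have
    index at least 1, where \<open>dL2\<close> applies.\<close>
  have ddL2: "dt \<tau> d n \<in> L2 \<Omega>" if "n \<ge> 2" for n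
    using L2_scaleR[OF L2_add[OF dL2[of n] L2_scaleR[OF dL2[of "n - 1"], of "-1"]], of "inverse \<tau>"] that
    by (simp add: dt_def[of \<tau> d])
  have int: "integrable (lebesgue_on \<Omega>) (\<lambda>x. (norm (d m x))\<^sup>2)"
    "integrable (lebesgue_on \<Omega>) (\<lambda>x. (norm (d 1 x))\<^sup>2)"
    "\<And>n. n \<in> {2..m} \<Longrightarrow> integrable (lebesgue_on \<Omega>) (\<lambda>x. (norm (dt \<tau> d n x))\<^sup>2)"
    using dL2[of m] dL2[of 1] ddL2 assms(2) by (auto simp: L2_def)
  then have int_S: "integrable (lebesgue_on \<Omega>) (\<lambda>x. \<tau>\<^sup>2 / 2 * ?S m x)"
    by (intro integrable_mult_right Bochner_Integration.integrable_add Bochner_Integration.integrable_sum)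
  ultimately have "l1_norm \<Omega> (\<lambda>x. (norm (u m x))\<^sup>2 - 1) = (\<integral>x. \<tau>\<^sup>2 / 2 * ?S m x \<partial>lebesgue_on \<Omega>)"
    unfolding l1_norm_def
    by (intro integral_cong_AE) (use u_norm_integrable[of m] in auto)
  also have "\<dots> = \<tau>\<^sup>2 / 2 * ((l2_norm \<Omega> (d m))\<^sup>2 + (l2_norm \<Omega> (d 1))\<^sup>2
       + \<tau>\<^sup>2 * (\<Sum>n=2..m. (l2_norm \<Omega> (dt \<tau> d n))\<^sup>2))"
    using int Bochner_Integration.integrable_sum[OF int(3), of "{2..m}" "\<lambda>n. n"]
    by (simp add: Bochner_Integration.integral_sum[OF int(3)] l2_norm_sq l2_inner_self)
  finally show ?thesis by simp
qed

text \<open>The positive \<open>\<tau>^2\<close> cancels in the exact identity, whose factor 1/2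
  becomes the 2 in \<open>2 * C\<close>.\<close>

lemma constraint_error_le_iff:
  assumes "\<mu> = 1/2" "m \<ge> 1"
  shows "l1_norm \<Omega> (\<lambda>x. (norm (u m x))\<^sup>2 - 1) \<le> C * \<tau>\<^sup>2 \<longleftrightarrow>
    (l2_norm \<Omega> (d m))\<^sup>2 + (l2_norm \<Omega> (d 1))\<^sup>2
      + \<tau>\<^sup>2 * (\<Sum>n=2..m. (l2_norm \<Omega> (dt \<tau> d n))\<^sup>2) \<le> 2 * C"
  unfolding constraint_error_quadratic[OF assms] using tau by (subst mult_le_cancel_right_pos) auto

end

section \<open>Uniform constants over all runs\<close>

text \<open>Choosing the constants as functions ahead of all other data encodes what they may depend
  on. In (b) both bounds are uniform over all step sizes and runs, and the last conjunct records the
  dependence of the quadratic constant on \<open>c\<close>.\<close>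

theorem proposition2p3:
  shows "\<exists>(C\<^sub>1 :: real \<Rightarrow> real \<Rightarrow> real) (C\<^sub>2 :: real \<Rightarrow> real \<Rightarrow> real \<Rightarrow> real).
    (\<forall>E cs. 0 < C\<^sub>1 E cs) \<and> (\<forall>E cs c. 0 < C\<^sub>2 E cs c) \<and>
    (\<forall>(\<Omega> :: (real ^ 'd) set) \<Gamma>\<^sub>D (u\<^sub>D :: real ^ 'd \<Rightarrow> real ^ 'l) ip cs \<theta> \<mu> u0.
       bounded_lipschitz_domain \<Omega> \<longrightarrow>
       dirichlet_part \<Omega> \<Gamma>\<^sub>D \<longrightarrow>
       (\<exists>ut \<in> H1 \<Omega>. unit_length \<Omega> ut \<and> trace_on \<Omega> \<Gamma>\<^sub>D ut u\<^sub>D) \<longrightarrow>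
       ip = l2_inner \<Omega> \<or> ip = grad_inner \<Omega> \<longrightarrow>
       cs > 0 \<longrightarrow>
       (\<forall>v \<in> H1D \<Omega> \<Gamma>\<^sub>D. l2_norm \<Omega> v \<le> sqrt cs * sqrt (ip v v)) \<longrightarrow>
       1/2 \<le> \<theta> \<longrightarrow> \<theta> \<le> 1 \<longrightarrow> 0 \<le> \<mu> \<longrightarrow> \<mu> \<le> 1 \<longrightarrow>
       u0 \<in> H1 \<Omega> \<longrightarrow> trace_on \<Omega> \<Gamma>\<^sub>D u0 u\<^sub>D \<longrightarrow> unit_length \<Omega> u0 \<longrightarrow>
       (let E = dirichlet_energy \<Omega> u0;
            generated = (\<lambda>\<tau> u. \<tau> > 0 \<and> theta_mu_method \<Omega> \<Gamma>\<^sub>D ip \<theta> \<mu> \<tau> u0 u);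
            constraint_error = (\<lambda>u m. l1_norm \<Omega> (\<lambda>x. (norm (u m x))\<^sup>2 - 1));
            stability_sum = (\<lambda>\<tau> u m.
              (l2_norm \<Omega> (dt \<tau> u m))\<^sup>2 + (l2_norm \<Omega> (dt \<tau> u 1))\<^sup>2
              + \<tau>\<^sup>2 * (\<Sum>n=2..m. (l2_norm \<Omega> (dt \<tau> (dt \<tau> u) n))\<^sup>2))
        in
          (\<forall>\<tau> u. generated \<tau> u \<longrightarrow> (\<forall>m\<ge>2. constraint_error u m \<le> C\<^sub>1 E cs * \<tau>)) \<and>
          (\<mu> = 1/2 \<longrightarrow>
             ((\<exists>c\<^sub>2>0. \<forall>\<tau> u. generated \<tau> u \<longrightarrow> (\<forall>m\<ge>2. constraint_error u m \<le> c\<^sub>2 * \<tau>\<^sup>2)) \<longleftrightarrow>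
              (\<exists>c>0. \<forall>\<tau> u. generated \<tau> u \<longrightarrow> (\<forall>m\<ge>2. stability_sum \<tau> u m \<le> c))) \<and>
             (\<forall>c>0. (\<forall>\<tau> u. generated \<tau> u \<longrightarrow> (\<forall>m\<ge>2. stability_sum \<tau> u m \<le> c)) \<longrightarrow>
                (\<forall>\<tau> u. generated \<tau> u \<longrightarrow> (\<forall>m\<ge>2. constraint_error u m \<le> C\<^sub>2 E cs c * \<tau>\<^sup>2))))))"
  unfolding Let_def
\<comment> \<open>Absolute values and \<open>+ 1\<close> make the witnesses positive for all real
  arguments. The exact identity would give \<open>c / 2\<close>, which
  \<open>\<bar>c\<bar> + 1\<close> dominates.\<close>
proof (intro exI[of _ "\<lambda>E cs. 3 * \<bar>cs * E\<bar> + 1"] exI[of _ "\<lambda>E cs c. \<bar>c\<bar> + 1"] conjI allI impI, goal_cases)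
  case (3 \<Omega> \<Gamma>\<^sub>D u\<^sub>D ip cs \<theta> \<mu> u0 \<tau> u m)
  then interpret theta_mu_iteration \<Omega> \<Gamma>\<^sub>D ip cs \<theta> \<mu> \<tau> u0 u
    by unfold_locales (auto simp: bounded_lipschitz_domain_def)
  have "l1_norm \<Omega> (\<lambda>x. (norm (u m x))\<^sup>2 - 1) \<le> 3 * cs * dirichlet_energy \<Omega> u0 * \<tau>"
    using constraint_error_linear[of m] 3 by simp
  also have "\<dots> \<le> (3 * \<bar>cs * dirichlet_energy \<Omega> u0\<bar> + 1) * \<tau>"
    using tau by (intro mult_right_mono) auto
  finally show ?case .
next
  case (4 \<Omega> \<Gamma>\<^sub>D u\<^sub>D ip cs \<theta> \<mu> u0)
  \<comment> \<open>The equivalence holds for each run and each \<open>m\<close> with the same pair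
    of constants \<open>C\<close> and \<open>2 * C\<close>, so it passes through the quantifiers
    over runs.\<close>
  have error_iff: "l1_norm \<Omega> (\<lambda>x. (norm (u m x))\<^sup>2 - 1) \<le> C * \<tau>\<^sup>2 \<longleftrightarrow>
      (l2_norm \<Omega> (dt \<tau> u m))\<^sup>2 + (l2_norm \<Omega> (dt \<tau> u 1))\<^sup>2
        + \<tau>\<^sup>2 * (\<Sum>n=2..m. (l2_norm \<Omega> (dt \<tau> (dt \<tau> u) n))\<^sup>2) \<le> 2 * C"
    if "\<tau> > 0 \<and> theta_mu_method \<Omega> \<Gamma>\<^sub>D ip \<theta> \<mu> \<tau> u0 u" "m \<ge> 2" for \<tau> u m C
  proof -
    from 4 that interpret theta_mu_iteration \<Omega> \<Gamma>\<^sub>D ip cs \<theta> \<mu> \<tau> u0 u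
      by unfold_locales (auto simp: bounded_lipschitz_domain_def)
    show ?thesis
      using 4 that by (intro constraint_error_le_iff) auto
  qed
  show ?case (is "(\<exists>c\<^sub>2>0. ?error c\<^sub>2) \<longleftrightarrow> (\<exists>c>0. ?stable c)")
  proof
    assume "\<exists>c\<^sub>2>0. ?error c\<^sub>2"
    then obtain c\<^sub>2 where "c\<^sub>2 > 0" "?error c\<^sub>2" by blast
    then have "2 * c\<^sub>2 > 0" "?stable (2 * c\<^sub>2)" using error_iff by simp_all
    then show "\<exists>c>0. ?stable c" by blast
  next
    assume "\<exists>c>0. ?stable c"
    then obtain c where "c > 0" "?stable c" by blast
    then have "c / 2 > 0" "?error (c / 2)" using error_iff[where C = "c / 2"] by simp_all
    then show "\<exists>c\<^sub>2>0. ?error c\<^sub>2" by blast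
  qed
next
  case (5 \<Omega> \<Gamma>\<^sub>D u\<^sub>D ip cs \<theta> \<mu> u0 c \<tau> u m)
  then interpret theta_mu_iteration \<Omega> \<Gamma>\<^sub>D ip cs \<theta> \<mu> \<tau> u0 u
    by unfold_locales (auto simp: bounded_lipschitz_domain_def)
  have "(l2_norm \<Omega> (dt \<tau> u m))\<^sup>2 + (l2_norm \<Omega> (dt \<tau> u 1))\<^sup>2
        + \<tau>\<^sup>2 * (\<Sum>n=2..m. (l2_norm \<Omega> (dt \<tau> (dt \<tau> u) n))\<^sup>2) \<le> c"
    using 5 by blast
  moreover have "c \<le> 2 * (\<bar>c\<bar> + 1)" by simp
  moreover have "\<mu> = 1/2" "1 \<le> m" using 5 by simp_all
  ultimately show ?case
    unfolding constraint_error_le_iff[OF \<open>\<mu> = 1/2\<close> \<open>1 \<le> m\<close>] by linarith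
qed auto

end
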